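(* Let $h\in C^2(\mathbb{R}^n)$, let $A:D(A)\to X'$ be Fréchet differentiable with Fréchet derivative $DA[u]:X\to X'$ at $u\in D(A)$, and let $(u^k)$ be the solution to the Runge-Kutta scheme $$u^{k}=u^{k-1}+\tau\sum_{i=1}^s b_iK_i,\qquad K_i=-A\Big[u^{k-1}+\tau\sum_{j=1}^s a_{ij}K_j\Big],\quad i=1,\dots,s .$$ Let $H[u]=\int_\Omega h(u(x))\,dx$. Suppose that for the given $k$, $$I_0^k:=\int_\Omega\Big(C_{\rm RK}\,h'(u^k)\,DA[u^k](A[u^k])+h''(u^k)(A[u^k])^2\Big)dx>0 .$$ Then there exists $\tau^k>0$ such that for all $0<\tau\le\tau^k$, $$H[u^k]+\tau\int_\Omega A[u^k]\,h'(u^k)\,dx\le H[u^{k-1}] .$$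
   Context: Setting: $X$ is a Banach space of functions $\Omega\to\mathbb{R}^n$ with dual $X'$, and $A$ is a (differential) operator defined on $D(A)\subset X$; the underlying Cauchy problem is $\partial_t u+A[u]=0$, $u(0)=u^0$. In the vector-valued case $h'(u)A[u]$ and $h'(u)DA[u](A[u])$ are inner products in $\mathbb{R}^n$, and $h''(u)(A[u])^2$ means $A[u]^\top h''(u)A[u]$ with the Hessian $h''$. Runge-Kutta scheme: $s\ge1$ stages, real coefficients $a_{ij},b_i$, $c_i:=\sum_{j=1}^s a_{ij}$, consistency $\sum_{i=1}^s b_i=1$, uniform time step $\tau>0$. The number $C_{\rm RK}:=2\sum_{i=1}^s b_i(1-c_i)$ equals $0$ for the implicit Euler scheme, $1$ for any Runge-Kutta scheme of order $p\ge2$, and $2$ for the explicit Euler scheme. Standing interpretation: $u^k=:u$ is a fixed function and the step size $\tau$ varies, so $u^{k-1}$ depends on $\tau$. The scheme is assumed backward solvable: there are $\tau_0>0$ and twice continuously differentiable maps $\tau\mapsto v(\tau)$, $\tau\mapsto K_i(\tau)$ on $[0,\tau_0)$ such that for each $\tau$ the scheme holds with this $u^k$, with $u^{k-1}=v(\tau)$ and stages $K_i(\tau)$ (so $v(0)=u$). In the conclusion, $u^{k-1}=v(\tau)$. All functions are assumed sufficiently regular that the integrals above are defined, that $\tau\mapsto A[v(\tau)+\tau\sum_j a_{ij}K_j(\tau)]$ can be differentiated by the chain rule, and that $\tau\mapsto\int_\Omega h(v(\tau))dx$ is $C^2$ with derivatives obtained by differentiating under the integral. *)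

theory Defs
  imports "HOL-Analysis.Analysis"
begin

text \<open>
  A Banach space X of functions from \<open>\<Omega>\<close> to \<open>\<real>\<^sup>n\<close> is a Banach space type \<open>'x\<close> together with a map R
  sending every element to a measurable representative.  Linearity and injectivity of R are
  required up to null sets only, so Lebesgue and Sobolev spaces are covered.
  The last clause (satisfied, for open \<open>\<Omega>\<close>, as soon as X contains the test functions) makes it
  meaningful to say that an element of X' \<^emph>\<open>is\<close> a function, see \<open>represents\<close> below.
\<close>

definition function_space ::
  "(real^'d) set \<Rightarrow> ('x::banach \<Rightarrow> real^'d \<Rightarrow> real^'n) \<Rightarrow> bool" where
  "function_space \<Omega> R \<longleftrightarrow>
     (\<forall>u. R u \<in> borel_measurable (lebesgue_on \<Omega>)) \<and>
     (\<forall>u v. AE x in lebesgue_on \<Omega>. R (u + v) x = R u x + R v x) \<and>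
     (\<forall>r u. AE x in lebesgue_on \<Omega>. R (r *\<^sub>R u) x = r *\<^sub>R R u x) \<and>
     (\<forall>u. (AE x in lebesgue_on \<Omega>. R u x = 0) \<longrightarrow> u = 0) \<and>
     (\<forall>f \<in> borel_measurable (lebesgue_on \<Omega>).
        (\<forall>w. integrable (lebesgue_on \<Omega>) (\<lambda>x. f x \<bullet> R w x) \<and>
             (LINT x|lebesgue_on \<Omega>. f x \<bullet> R w x) = 0) \<longrightarrow>
        (AE x in lebesgue_on \<Omega>. f x = 0))"

text \<open>
  The dual X' is the type \<open>'x \<Rightarrow>\<^sub>L real\<close>.  An element \<open>\<phi>\<close> of X' is identified with the function f
  if \<open>\<phi>\<close> is integration against f; in a \<open>function_space\<close>, f is then unique up to null sets.
\<close>

definition represents ::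
  "(real^'d) set \<Rightarrow> ('x::banach \<Rightarrow> real^'d \<Rightarrow> real^'n) \<Rightarrow>
   (real^'d \<Rightarrow> real^'n) \<Rightarrow> ('x \<Rightarrow>\<^sub>L real) \<Rightarrow> bool" where
  "represents \<Omega> R f \<phi> \<longleftrightarrow>
     f \<in> borel_measurable (lebesgue_on \<Omega>) \<and>
     (\<forall>w. integrable (lebesgue_on \<Omega>) (\<lambda>x. f x \<bullet> R w x) \<and>
          blinfun_apply \<phi> w = (LINT x|lebesgue_on \<Omega>. f x \<bullet> R w x))"

definition C2_fun :: 
  "(real^'n \<Rightarrow> real) \<Rightarrow> (real^'n \<Rightarrow> real^'n) \<Rightarrow> (real^'n \<Rightarrow> real^'n^'n) \<Rightarrow> bool" where
  "C2_fun h grad hess \<longleftrightarrow>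
     (\<forall>z. (h has_derivative (\<lambda>y. grad z \<bullet> y)) (at z)) \<and>
     (\<forall>z. (grad has_derivative (\<lambda>y. hess z *v y)) (at z)) \<and>
     continuous_on UNIV hess"

definition C2_curve ::
  "real \<Rightarrow> (real \<Rightarrow> 'a::real_normed_vector) \<Rightarrow> (real \<Rightarrow> 'a) \<Rightarrow> (real \<Rightarrow> 'a) \<Rightarrow> bool" where
  "C2_curve T f f' f'' \<longleftrightarrow>
     (\<forall>t\<in>{0..<T}. (f has_vector_derivative f' t) (at t within {0..<T})) \<and>
     (\<forall>t\<in>{0..<T}. (f' has_vector_derivative f'' t) (at t within {0..<T})) \<and>
     continuous_on {0..<T} f''"

definition rk_c :: "nat \<Rightarrow> (nat \<Rightarrow> nat \<Rightarrow> real) \<Rightarrow> nat \<Rightarrow> real" where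
  "rk_c s a i = (\<Sum>j=1..s. a i j)"

definition C_RK :: "nat \<Rightarrow> (nat \<Rightarrow> nat \<Rightarrow> real) \<Rightarrow> (nat \<Rightarrow> real) \<Rightarrow> real" where
  "C_RK s a b = 2 * (\<Sum>i=1..s. b i * (1 - rk_c s a i))"

definition rk_arg ::
  "nat \<Rightarrow> (nat \<Rightarrow> nat \<Rightarrow> real) \<Rightarrow> real \<Rightarrow> 'x::real_vector \<Rightarrow> (nat \<Rightarrow> 'x) \<Rightarrow> nat \<Rightarrow> 'x" where
  "rk_arg s a \<tau> w k i = w + \<tau> *\<^sub>R (\<Sum>j=1..s. a i j *\<^sub>R k j)"

text \<open>One step of the scheme with step size \<open>\<tau>\<close>, leading from w to u with stages k.  The stage
  equation \<open>k i = - A[\<dots>]\<close> equates an element of X with an element of X'.\<close>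

definition rk_step ::
  "(real^'d) set \<Rightarrow> ('x::banach \<Rightarrow> real^'d \<Rightarrow> real^'n) \<Rightarrow> 'x set \<Rightarrow> ('x \<Rightarrow> ('x \<Rightarrow>\<^sub>L real)) \<Rightarrow>
   nat \<Rightarrow> (nat \<Rightarrow> nat \<Rightarrow> real) \<Rightarrow> (nat \<Rightarrow> real) \<Rightarrow> real \<Rightarrow> 'x \<Rightarrow> (nat \<Rightarrow> 'x) \<Rightarrow> 'x \<Rightarrow> bool" where
  "rk_step \<Omega> R D A s a b \<tau> w k u \<longleftrightarrow>
     u = w + \<tau> *\<^sub>R (\<Sum>i=1..s. b i *\<^sub>R k i) \<and>
     (\<forall>i\<in>{1..s}. rk_arg s a \<tau> w k i \<in> D \<and>
                 represents \<Omega> R (R (k i)) (- A (rk_arg s a \<tau> w k i)))"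

definition entropy ::
  "(real^'d) set \<Rightarrow> ('x \<Rightarrow> real^'d \<Rightarrow> real^'n) \<Rightarrow> (real^'n \<Rightarrow> real) \<Rightarrow> 'x \<Rightarrow> real" where
  "entropy \<Omega> R h u = (LINT x|lebesgue_on \<Omega>. h (R u x))"

text \<open>The entropy along the curve v (with derivatives v', v'' in X) is \<open>C\<^sup>2\<close>, and its derivatives
  are obtained by differentiating under the integral.\<close>

definition entropy_C2 ::
  "(real^'d) set \<Rightarrow> ('x \<Rightarrow> real^'d \<Rightarrow> real^'n) \<Rightarrow>
   (real^'n \<Rightarrow> real) \<Rightarrow> (real^'n \<Rightarrow> real^'n) \<Rightarrow> (real^'n \<Rightarrow> real^'n^'n) \<Rightarrow>
   real \<Rightarrow> (real \<Rightarrow> 'x) \<Rightarrow> (real \<Rightarrow> 'x) \<Rightarrow> (real \<Rightarrow> 'x) \<Rightarrow> bool" where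
  "entropy_C2 \<Omega> R h grad hess T v v' v'' \<longleftrightarrow>
     (\<forall>t\<in>{0..<T}.
        integrable (lebesgue_on \<Omega>) (\<lambda>x. h (R (v t) x)) \<and>
        integrable (lebesgue_on \<Omega>) (\<lambda>x. grad (R (v t) x) \<bullet> R (v' t) x) \<and>
        integrable (lebesgue_on \<Omega>)
          (\<lambda>x. grad (R (v t) x) \<bullet> R (v'' t) x + R (v' t) x \<bullet> (hess (R (v t) x) *v R (v' t) x))) \<and>
     C2_curve T
       (\<lambda>t. entropy \<Omega> R h (v t))
       (\<lambda>t. LINT x|lebesgue_on \<Omega>. grad (R (v t) x) \<bullet> R (v' t) x)
       (\<lambda>t. LINT x|lebesgue_on \<Omega>.
          grad (R (v t) x) \<bullet> R (v'' t) x + R (v' t) x \<bullet> (hess (R (v t) x) *v R (v' t) x))"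

text \<open>Differentiability of the stage equations: the derivative in X' of \<open>t \<mapsto> A[v(t) + t \<Sum> a\<^sub>i\<^sub>j K\<^sub>j(t)]\<close>
  (given by the chain rule and the derivative of A) and the derivative in X of
  \<open>t \<mapsto> - K\<^sub>i(t)\<close> are the same function.\<close>

definition stages_differentiable ::
  "(real^'d) set \<Rightarrow> ('x::banach \<Rightarrow> real^'d \<Rightarrow> real^'n) \<Rightarrow> ('x \<Rightarrow> ('x \<Rightarrow>\<^sub>L real)) \<Rightarrow>
   nat \<Rightarrow> (nat \<Rightarrow> nat \<Rightarrow> real) \<Rightarrow> real \<Rightarrow> (real \<Rightarrow> 'x) \<Rightarrow> (nat \<Rightarrow> real \<Rightarrow> 'x) \<Rightarrow> (nat \<Rightarrow> real \<Rightarrow> 'x) \<Rightarrow> bool"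
  where
  "stages_differentiable \<Omega> R A s a T v K K' \<longleftrightarrow>
     (\<forall>i\<in>{1..s}. \<forall>t\<in>{0..<T}.
        represents \<Omega> R (R (K' i t))
          (- vector_derivative (\<lambda>t. A (rk_arg s a t (v t) (\<lambda>j. K j t) i)) (at t within {0..<T})))"

end

theory Submission
  imports Defs
begin

text \<open>
  Fix \<open>u = u\<^sup>k\<close> and regard \<open>f \<tau> = H[v(\<tau>)]\<close> as a function of the step size.  The claim says that the graph
  of f stays above its tangent at \<open>\<tau> = 0\<close> for small \<open>\<tau>\<close>, and this follows from \<open>f''(0) > 0\<close>
  (\<open>above_tangent_near_zero\<close>).  It remains to recognise the tangent and to see that \<open>f''(0) = I\<^sub>0\<^sup>k\<close>.

  Read backwards, the scheme is \<open>v(\<tau>) = u - \<tau> G(\<tau>)\<close> with \<open>G = \<Sum> b\<^sub>i K\<^sub>i\<close>, so \<open>v'(0) = - G(0)\<close> and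
  \<open>v''(0) = - 2 G'(0)\<close> (\<open>backward_curve_derivatives\<close>).  At \<open>\<tau> = 0\<close> every stage is \<open>K\<^sub>i(0) = - A[u]\<close>, and
  consistency gives \<open>v'(0) = A[u]\<close>.  The argument of A in the i-th stage then leaves u with velocity
  \<open>v'(0) + \<Sum>\<^sub>j a\<^sub>i\<^sub>j K\<^sub>j(0) = (1 - c\<^sub>i) A[u]\<close>; the chain rule yields \<open>K\<^sub>i'(0) = - (1 - c\<^sub>i) DA[u](A[u])\<close>
  (\<open>stage_derivative_at_zero\<close>), whence \<open>v''(0) = 2 \<Sum> b\<^sub>i (1 - c\<^sub>i) DA[u](A[u]) = C\<^sub>R\<^sub>K DA[u](A[u])\<close>.  Inserting
  \<open>v'(0)\<close> and \<open>v''(0)\<close> into the second derivative of the entropy gives \<open>I\<^sub>0\<^sup>k\<close>.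

  The stage equations live in X' and only hold there after elements of X have been identified with
  functionals, while \<open>DA[u](A[u])\<close> is merely a function and need not belong to X.  All identifications are
  therefore made through \<open>represents_unique\<close>, as equalities almost everywhere.
\<close>

section \<open>Functions representing functionals\<close>

lemma function_space_add:
  assumes "function_space \<Omega> R"
  shows "AE x in lebesgue_on \<Omega>. R (u + v) x = R u x + R v x"
proof -
  have "\<forall>u v. AE x in lebesgue_on \<Omega>. R (u + v) x = R u x + R v x"
    using assms unfolding function_space_def by (elim conjE)
  then show ?thesis by (elim allE)
qed

lemma function_space_scaleR:
  assumes "function_space \<Omega> R"
  shows "AE x in lebesgue_on \<Omega>. R (r *\<^sub>R u) x = r *\<^sub>R R u x"
proof -
  have "\<forall>r u. AE x in lebesgue_on \<Omega>. R (r *\<^sub>R u) x = r *\<^sub>R R u x"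
    using assms unfolding function_space_def by (elim conjE)
  then show ?thesis by (elim allE)
qed

lemma function_space_eq_0:
  assumes "function_space \<Omega> R" "AE x in lebesgue_on \<Omega>. R u x = 0"
  shows "u = 0"
proof -
  have "\<forall>u. (AE x in lebesgue_on \<Omega>. R u x = 0) \<longrightarrow> u = 0"
    using assms(1) unfolding function_space_def by (elim conjE)
  from spec[OF this, THEN mp, OF assms(2)] show ?thesis .
qed

lemma function_space_measurable:
  assumes "function_space \<Omega> R"
  shows "R u \<in> borel_measurable (lebesgue_on \<Omega>)"
  using assms unfolding function_space_def by (elim conjE) (erule spec)

text \<open>
  The difference of two representatives annihilates every element of X, and in a \<open>function_space\<close> only
  null functions do that.
\<close>

lemma represents_unique:
  fixes R :: "'x::banach \<Rightarrow> real^'d \<Rightarrow> real^'n"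
  assumes "function_space \<Omega> R" "represents \<Omega> R f \<phi>" "represents \<Omega> R g \<phi>"
  shows "AE x in lebesgue_on \<Omega>. f x = g x"
proof -
  let ?d = "\<lambda>x. f x - g x"
  have meas: "?d \<in> borel_measurable (lebesgue_on \<Omega>)"
    using assms(2,3) unfolding represents_def by (intro borel_measurable_diff) auto
  have zero: "\<forall>w. integrable (lebesgue_on \<Omega>) (\<lambda>x. ?d x \<bullet> R w x) \<and>
      (LINT x|lebesgue_on \<Omega>. ?d x \<bullet> R w x) = 0"
  proof
    fix w
    have "integrable (lebesgue_on \<Omega>) (\<lambda>x. f x \<bullet> R w x)" "integrable (lebesgue_on \<Omega>) (\<lambda>x. g x \<bullet> R w x)"
      "(LINT x|lebesgue_on \<Omega>. f x \<bullet> R w x) = (LINT x|lebesgue_on \<Omega>. g x \<bullet> R w x)"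
      using assms(2,3) unfolding represents_def by auto
    then show "integrable (lebesgue_on \<Omega>) (\<lambda>x. ?d x \<bullet> R w x) \<and>
        (LINT x|lebesgue_on \<Omega>. ?d x \<bullet> R w x) = 0"
      by (simp add: inner_diff_left)
  qed
  have "\<forall>f \<in> borel_measurable (lebesgue_on \<Omega>).
      (\<forall>w. integrable (lebesgue_on \<Omega>) (\<lambda>x. f x \<bullet> R w x) \<and>
           (LINT x|lebesgue_on \<Omega>. f x \<bullet> R w x) = 0) \<longrightarrow>
      (AE x in lebesgue_on \<Omega>. f x = 0)"
    using assms(1) unfolding function_space_def by (elim conjE)
  from bspec[OF this meas, THEN mp, OF zero]
  have "AE x in lebesgue_on \<Omega>. ?d x = 0" .
  then show ?thesis by simp
qed

lemma represents_scaleR: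
  assumes "represents \<Omega> R f \<phi>"
  shows "represents \<Omega> R (\<lambda>x. c *\<^sub>R f x) (c *\<^sub>R \<phi>)"
  using assms unfolding represents_def by (auto simp: scaleR_blinfun.rep_eq)

lemma function_space_sum:
  assumes R: "function_space \<Omega> R" and "finite I"
  shows "AE x in lebesgue_on \<Omega>. R (\<Sum>i\<in>I. c i *\<^sub>R w i) x = (\<Sum>i\<in>I. c i *\<^sub>R R (w i) x)"
  using \<open>finite I\<close>
proof (induction I rule: finite_induct)
  case empty
  show ?case using function_space_scaleR[OF R, of 0 0] by simp
next
  case (insert i I)
  let ?S = "\<Sum>i\<in>I. c i *\<^sub>R w i"
  from function_space_add[OF R, of "c i *\<^sub>R w i" ?S] function_space_scaleR[OF R, of "c i" "w i"] insert.IH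
  have "AE x in lebesgue_on \<Omega>.
      R (c i *\<^sub>R w i + ?S) x = c i *\<^sub>R R (w i) x + (\<Sum>i\<in>I. c i *\<^sub>R R (w i) x)"
    by eventually_elim simp
  then show ?case using insert.hyps by simp
qed

lemma function_space_eqI:
  assumes R: "function_space \<Omega> R" and eq: "AE x in lebesgue_on \<Omega>. R w x = c *\<^sub>R R u x"
  shows "w = c *\<^sub>R u"
proof -
  from function_space_add[OF R, of w "(- c) *\<^sub>R u"] function_space_scaleR[OF R, of "- c" u] eq
  have "AE x in lebesgue_on \<Omega>. R (w + (- c) *\<^sub>R u) x = 0"
    by eventually_elim simp
  then have "w + (- c) *\<^sub>R u = 0"
    by (rule function_space_eq_0[OF R])
  then show ?thesis by simp
qed

section \<open>Curves on a half-open interval\<close>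

lemma at_within_Ico_neq_bot:
  fixes t T :: real
  assumes "t \<in> {0..<T}"
  shows "at t within {0..<T} \<noteq> bot"
proof -
  have "t islimpt {t<..<T}"
    using assms by (simp add: islimpt_greaterThanLessThan1)
  then have "t islimpt {0..<T}"
    by (rule islimpt_subset) (use assms in auto)
  then show ?thesis by (simp add: trivial_limit_within)
qed

lemma C2_curve_sum:
  assumes "\<And>i. i \<in> I \<Longrightarrow> C2_curve T (K i) (K' i) (K'' i)"
  shows "C2_curve T (\<lambda>t. \<Sum>i\<in>I. c i *\<^sub>R K i t) (\<lambda>t. \<Sum>i\<in>I. c i *\<^sub>R K' i t) (\<lambda>t. \<Sum>i\<in>I. c i *\<^sub>R K'' i t)"
  unfolding C2_curve_def
proof (intro conjI ballI)
  fix t assume "t \<in> {0..<T}"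
  then have K: "(K i has_vector_derivative K' i t) (at t within {0..<T})"
    "(K' i has_vector_derivative K'' i t) (at t within {0..<T})" if "i \<in> I" for i
    using assms[OF that] unfolding C2_curve_def by auto
  show "((\<lambda>t. \<Sum>i\<in>I. c i *\<^sub>R K i t) has_vector_derivative (\<Sum>i\<in>I. c i *\<^sub>R K' i t)) (at t within {0..<T})"
    by (intro has_vector_derivative_sum bounded_linear.has_vector_derivative[OF bounded_linear_scaleR_right] K)
  show "((\<lambda>t. \<Sum>i\<in>I. c i *\<^sub>R K' i t) has_vector_derivative (\<Sum>i\<in>I. c i *\<^sub>R K'' i t)) (at t within {0..<T})"
    by (intro has_vector_derivative_sum bounded_linear.has_vector_derivative[OF bounded_linear_scaleR_right] K)
next
  show "continuous_on {0..<T} (\<lambda>t. \<Sum>i\<in>I. c i *\<^sub>R K'' i t)"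
    using assms unfolding C2_curve_def by (intro continuous_intros) auto
qed

text \<open>
  The product rule for \<open>v(t) = u - t G(t)\<close>: the factor 2 in \<open>v''(0)\<close> comes from \<open>v'' = - 2 G' - t G''\<close> and
  is the factor 2 in \<open>C\<^sub>R\<^sub>K\<close>.  The derivatives \<open>v'\<close> and \<open>v''\<close> are given in advance and get
  identified by uniqueness of one-sided derivatives.
\<close>

lemma backward_curve_derivatives:
  fixes v G :: "real \<Rightarrow> 'a::real_normed_vector"
  assumes "T > 0" and v: "C2_curve T v v' v''" and G: "C2_curve T G G' G''"
    and vG: "\<And>t. t \<in> {0..<T} \<Longrightarrow> v t = u - t *\<^sub>R G t"
  shows "v' 0 = - G 0" and "v'' 0 = - 2 *\<^sub>R G' 0"
proof -
  have v'_eq: "v' t = - (t *\<^sub>R G' t + G t)" if t: "t \<in> {0..<T}" for t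
  proof -
    have "(G has_vector_derivative G' t) (at t within {0..<T})"
      using G t unfolding C2_curve_def by blast
    then have "((\<lambda>t. u - t *\<^sub>R G t) has_vector_derivative 0 - (t *\<^sub>R G' t + 1 *\<^sub>R G t)) (at t within {0..<T})"
      by (intro has_vector_derivative_diff has_vector_derivative_scaleR has_vector_derivative_const DERIV_ident)
    then have "(v has_vector_derivative - (t *\<^sub>R G' t + G t)) (at t within {0..<T})"
      using t vG by (auto intro: has_vector_derivative_transform)
    moreover have "(v has_vector_derivative v' t) (at t within {0..<T})"
      using v t unfolding C2_curve_def by blast
    ultimately show ?thesis
      using vector_derivative_unique_within[OF at_within_Ico_neq_bot[OF t]] by blast
  qed
  have zero: "0 \<in> {0..<T}" using \<open>T > 0\<close> by simp
  show "v' 0 = - G 0" using v'_eq[OF zero] by simp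
  have "(G has_vector_derivative G' 0) (at 0 within {0..<T})"
    and "(G' has_vector_derivative G'' 0) (at 0 within {0..<T})"
    using G zero unfolding C2_curve_def by blast+
  then have "((\<lambda>t. - (t *\<^sub>R G' t + G t)) has_vector_derivative - ((0 *\<^sub>R G'' 0 + 1 *\<^sub>R G' 0) + G' 0))
      (at 0 within {0..<T})"
    by (intro has_vector_derivative_minus has_vector_derivative_add has_vector_derivative_scaleR DERIV_ident)
  then have "(v' has_vector_derivative - 2 *\<^sub>R G' 0) (at 0 within {0..<T})"
    using zero v'_eq by (auto intro: has_vector_derivative_transform simp: scaleR_2)
  moreover have "(v' has_vector_derivative v'' 0) (at 0 within {0..<T})"
    using v zero unfolding C2_curve_def by blast
  ultimately show "v'' 0 = - 2 *\<^sub>R G' 0"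
    using vector_derivative_unique_within[OF at_within_Ico_neq_bot[OF zero]] by blast
qed

text \<open>
  Since \<open>f''(0) > 0\<close>, the slope \<open>f'\<close> exceeds \<open>f'(0)\<close> just to the right of 0, and the mean value theorem
  turns this into a bound for f.
\<close>

lemma above_tangent_near_zero:
  fixes f f' f'' :: "real \<Rightarrow> real"
  assumes "T > 0" and f: "C2_curve T f f' f''" and pos: "f'' 0 > 0"
  shows "\<exists>\<epsilon>>0. \<epsilon> < T \<and> (\<forall>t. 0 < t \<and> t \<le> \<epsilon> \<longrightarrow> f 0 + t * f' 0 \<le> f t)"
proof -
  have "(f' has_real_derivative f'' 0) (at 0 within {0..<T})"
    using f \<open>T > 0\<close> unfolding C2_curve_def by (auto simp: has_real_derivative_iff_has_vector_derivative)
  from has_real_derivative_pos_inc_right[OF this pos]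
  obtain d where "d > 0" and d: "\<And>t. 0 < t \<Longrightarrow> t < T \<Longrightarrow> t < d \<Longrightarrow> f' 0 < f' t"
    by auto
  define \<epsilon> where "\<epsilon> = min d T / 2"
  have \<epsilon>: "\<epsilon> > 0" "\<epsilon> < T" "\<epsilon> < d"
    using \<open>d > 0\<close> \<open>T > 0\<close> by (auto simp: \<epsilon>_def min_def)
  have "f 0 + t * f' 0 \<le> f t" if t: "0 < t" "t \<le> \<epsilon>" for t
  proof -
    have "(f has_derivative (\<lambda>h. h * f' x)) (at x within {0..t})" if "0 \<le> x" "x \<le> t" for x
    proof -
      have "(f has_vector_derivative f' x) (at x within {0..<T})"
        using f that t \<epsilon> unfolding C2_curve_def by auto
      then have "(f has_vector_derivative f' x) (at x within {0..t})"
        by (rule has_vector_derivative_within_subset) (use t \<epsilon> in auto)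
      then show ?thesis by (simp add: has_vector_derivative_def)
    qed
    from mvt_simple[OF t(1), of f "\<lambda>x h. h * f' x", OF this]
    obtain z where z: "z \<in> {0<..<t}" "f t - f 0 = t * f' z" by auto
    have "f' 0 \<le> f' z" using d[of z] z t \<epsilon> by auto
    then have "t * f' 0 \<le> t * f' z" using t(1) by (intro mult_left_mono) auto
    then show ?thesis using z(2) by linarith
  qed
  then show ?thesis using \<epsilon> by blast
qed

section \<open>The stages of a backward step at step size zero\<close>

lemma stage_at_zero:
  fixes R :: "'x::banach \<Rightarrow> real^'d \<Rightarrow> real^'n"
  assumes R: "function_space \<Omega> R"
    and step: "rk_step \<Omega> R D A s a b 0 w k u" and i: "i \<in> {1..s}"
    and Au: "represents \<Omega> R (R Au) (A u)"
  shows "u \<in> D" and "k i = - Au"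
proof -
  have "w = u" using step unfolding rk_step_def by simp
  then have "u \<in> D" and k: "represents \<Omega> R (R (k i)) (- A u)"
    using step i unfolding rk_step_def rk_arg_def by auto
  show "u \<in> D" by fact
  have "represents \<Omega> R (\<lambda>x. (- 1) *\<^sub>R R Au x) (- A u)"
    using represents_scaleR[OF Au, of "- 1"] by simp
  then have "k i = (- 1) *\<^sub>R Au"
    by (intro function_space_eqI[OF R] represents_unique[OF R k])
  then show "k i = - Au" by simp
qed

text \<open>
  The velocity \<open>v'(0) + \<Sum>\<^sub>j a\<^sub>i\<^sub>j K\<^sub>j(0)\<close> of the i-th stage argument is a multiple of \<open>A[u]\<close>, because every
  stage is \<open>- A[u]\<close> at \<open>t = 0\<close>.  This is why \<open>K\<^sub>i'(0)\<close> depends on the tableau only through \<open>c\<^sub>i\<close>.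
\<close>

lemma stage_derivative_at_zero:
  fixes R :: "'x::banach \<Rightarrow> real^'d \<Rightarrow> real^'n"
    and A :: "'x \<Rightarrow> ('x \<Rightarrow>\<^sub>L real)" and DAu :: "'x \<Rightarrow>\<^sub>L ('x \<Rightarrow>\<^sub>L real)"
  assumes R: "function_space \<Omega> R" and "T > 0"
    and A: "(A has_derivative blinfun_apply DAu) (at u within D)"
    and v: "(v has_vector_derivative Au) (at 0 within {0..<T})" and v0: "v 0 = u"
    and K: "\<And>j. j \<in> {1..s} \<Longrightarrow> (K j has_vector_derivative K' j 0) (at 0 within {0..<T})"
    and K0: "\<And>j. j \<in> {1..s} \<Longrightarrow> K j 0 = - Au"
    and D: "\<And>t. t \<in> {0..<T} \<Longrightarrow> rk_arg s a t (v t) (\<lambda>j. K j t) i \<in> D"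
    and diff: "stages_differentiable \<Omega> R A s a T v K K'" and i: "i \<in> {1..s}"
    and g: "represents \<Omega> R g (blinfun_apply DAu Au)"
  shows "AE x in lebesgue_on \<Omega>. R (K' i 0) x = - (1 - rk_c s a i) *\<^sub>R g x"
proof -
  let ?y = "\<lambda>t. rk_arg s a t (v t) (\<lambda>j. K j t) i"
  let ?S = "\<Sum>j=1..s. a i j *\<^sub>R K j 0" and ?S' = "\<Sum>j=1..s. a i j *\<^sub>R K' j 0"
  have zero: "0 \<in> {0..<T}" using \<open>T > 0\<close> by simp
  have "?S = (\<Sum>j=1..s. - (a i j *\<^sub>R Au))"
    by (rule sum.cong) (auto simp: K0)
  also have "\<dots> = - (rk_c s a i *\<^sub>R Au)"
    by (simp add: rk_c_def sum_negf scaleR_left.sum)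
  finally have S: "?S = - (rk_c s a i *\<^sub>R Au)" .
  have velocity: "Au + (0 *\<^sub>R ?S' + 1 *\<^sub>R ?S) = (1 - rk_c s a i) *\<^sub>R Au"
    unfolding S by (simp add: scaleR_left_diff_distrib)
  have "(?y has_vector_derivative Au + (0 *\<^sub>R ?S' + 1 *\<^sub>R ?S)) (at 0 within {0..<T})"
    unfolding rk_arg_def
    by (intro has_vector_derivative_add has_vector_derivative_scaleR has_vector_derivative_sum
        bounded_linear.has_vector_derivative[OF bounded_linear_scaleR_right] DERIV_ident v K)
  then have y: "(?y has_vector_derivative (1 - rk_c s a i) *\<^sub>R Au) (at 0 within {0..<T})"
    unfolding velocity .
  have y0: "?y 0 = u" by (simp add: rk_arg_def v0)
  have "(A has_derivative blinfun_apply DAu) (at (?y 0) within ?y ` {0..<T})"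
    unfolding y0 by (rule has_derivative_subset[OF A]) (use D in auto)
  from vector_derivative_diff_chain_within[OF y this]
  have "((\<lambda>t. A (?y t)) has_vector_derivative (1 - rk_c s a i) *\<^sub>R blinfun_apply DAu Au) (at 0 within {0..<T})"
    by (simp add: o_def blinfun.scaleR_right)
  then have vd: "vector_derivative (\<lambda>t. A (?y t)) (at 0 within {0..<T}) = (1 - rk_c s a i) *\<^sub>R blinfun_apply DAu Au"
    by (rule vector_derivative_within[OF at_within_Ico_neq_bot[OF zero]])
  have "represents \<Omega> R (R (K' i 0)) (- vector_derivative (\<lambda>t. A (?y t)) (at 0 within {0..<T}))"
    using diff i zero unfolding stages_differentiable_def by blast
  then have "represents \<Omega> R (R (K' i 0)) (- (1 - rk_c s a i) *\<^sub>R blinfun_apply DAu Au)"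
    by (simp only: vd scaleR_minus_left)
  from represents_unique[OF R this represents_scaleR[OF g]] show ?thesis .
qed

text \<open>
  The second derivative of the entropy involves the representative of \<open>v''(0)\<close>, which is only known almost
  everywhere.  Equality of Bochner integrals of functions that agree almost everywhere needs both to be
  measurable; the Hessian term r inherits this from the integrand that contains it.
\<close>

lemma second_variation_cong_AE:
  fixes h' :: "real^'n \<Rightarrow> real^'n" and p q q' g :: "'a \<Rightarrow> real^'n" and r :: "'a \<Rightarrow> real"
  assumes h': "continuous_on UNIV h'"
    and [measurable]: "p \<in> borel_measurable M" "q \<in> borel_measurable M" "g \<in> borel_measurable M"
    and int: "integrable M (\<lambda>x. h' (p x) \<bullet> q x + r x)"
    and eq: "AE x in M. q x = c *\<^sub>R g x"
  shows "(LINT x|M. h' (p x) \<bullet> q x + r x) = (LINT x|M. c * (h' (p x) \<bullet> g x) + r x)"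
proof (rule integral_cong_AE)
  have [measurable]: "h' \<in> borel_measurable borel"
    by (rule borel_measurable_continuous_onI[OF h'])
  have sum: "(\<lambda>x. h' (p x) \<bullet> q x + r x) \<in> borel_measurable M"
    using int by (rule borel_measurable_integrable)
  then have "(\<lambda>x. (h' (p x) \<bullet> q x + r x) - h' (p x) \<bullet> q x) \<in> borel_measurable M"
    by (rule borel_measurable_diff) measurable
  then have [measurable]: "r \<in> borel_measurable M" by simp
  show "(\<lambda>x. h' (p x) \<bullet> q x + r x) \<in> borel_measurable M" by (fact sum)
  show "(\<lambda>x. c * (h' (p x) \<bullet> g x) + r x) \<in> borel_measurable M" by measurable
  show "AE x in M. h' (p x) \<bullet> q x + r x = c * (h' (p x) \<bullet> g x) + r x"
    using eq by eventually_elim simp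
qed

section \<open>Dissipation of the entropy along a Runge-Kutta step\<close>

theorem theorem1:
  fixes \<Omega> :: "(real^'d) set"
    and R :: "'x::banach \<Rightarrow> real^'d \<Rightarrow> real^'n"
    and D :: "'x set"
    and A :: "'x \<Rightarrow> ('x \<Rightarrow>\<^sub>L real)"
    and DA :: "'x \<Rightarrow> ('x \<Rightarrow>\<^sub>L ('x \<Rightarrow>\<^sub>L real))"
    and h :: "real^'n \<Rightarrow> real"
    and h' :: "real^'n \<Rightarrow> real^'n"
    and h'' :: "real^'n \<Rightarrow> real^'n^'n"
    and s :: nat and a :: "nat \<Rightarrow> nat \<Rightarrow> real" and b :: "nat \<Rightarrow> real"
    and u Au :: 'x and DAu_Au :: "real^'d \<Rightarrow> real^'n"
    and \<tau>\<^sub>0 :: real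
    and v v' v'' :: "real \<Rightarrow> 'x"
    and K K' K'' :: "nat \<Rightarrow> real \<Rightarrow> 'x"
  assumes "\<Omega> \<in> sets lebesgue"
    and "function_space \<Omega> R"
    and "C2_fun h h' h''"
    and "\<And>w. w \<in> D \<Longrightarrow> (A has_derivative blinfun_apply (DA w)) (at w within D)"
    and "s \<ge> 1"
    and "(\<Sum>i=1..s. b i) = 1"
    and "\<tau>\<^sub>0 > 0"
    and "\<And>\<tau>. \<tau> \<in> {0..<\<tau>\<^sub>0} \<Longrightarrow> rk_step \<Omega> R D A s a b \<tau> (v \<tau>) (\<lambda>i. K i \<tau>) u"
    and "C2_curve \<tau>\<^sub>0 v v' v''"
    and "\<And>i. i \<in> {1..s} \<Longrightarrow> C2_curve \<tau>\<^sub>0 (K i) (K' i) (K'' i)"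
    and "stages_differentiable \<Omega> R A s a \<tau>\<^sub>0 v K K'"
    and "entropy_C2 \<Omega> R h h' h'' \<tau>\<^sub>0 v v' v''"
    and "represents \<Omega> R (R Au) (A u)"
    and "represents \<Omega> R DAu_Au (blinfun_apply (DA u) Au)"
    and "(LINT x|lebesgue_on \<Omega>. C_RK s a b * (h' (R u x) \<bullet> DAu_Au x)
            + R Au x \<bullet> (h'' (R u x) *v R Au x)) > 0"
  shows "\<exists>\<tau>\<^sub>k>0. \<tau>\<^sub>k < \<tau>\<^sub>0 \<and> (\<forall>\<tau>. 0 < \<tau> \<and> \<tau> \<le> \<tau>\<^sub>k \<longrightarrow>
           entropy \<Omega> R h u + \<tau> * (LINT x|lebesgue_on \<Omega>. R Au x \<bullet> h' (R u x))
             \<le> entropy \<Omega> R h (v \<tau>))"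
proof -
  note R = assms(2) and T = assms(7) and step = assms(8) and v = assms(9) and K = assms(10)
    and ent = assms(12) and Au = assms(13) and DAu = assms(14)
  let ?M = "lebesgue_on \<Omega>"
  let ?G = "\<lambda>t. \<Sum>i=1..s. b i *\<^sub>R K i t" and ?G' = "\<lambda>t. \<Sum>i=1..s. b i *\<^sub>R K' i t"
  have zero: "0 \<in> {0..<\<tau>\<^sub>0}" using T by simp
  have vG: "v t = u - t *\<^sub>R ?G t" if "t \<in> {0..<\<tau>\<^sub>0}" for t
    using step[OF that] unfolding rk_step_def by (metis add_diff_cancel_right')
  have v0: "v 0 = u" using vG[OF zero] by simp
  have K0: "K i 0 = - Au" if "i \<in> {1..s}" for i
    using stage_at_zero(2)[OF R step[OF zero] that Au] .
  have uD: "u \<in> D"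
    using stage_at_zero(1)[OF R step[OF zero] _ Au, of 1] \<open>s \<ge> 1\<close> by simp
  note deriv = backward_curve_derivatives[OF T v C2_curve_sum[OF K] vG]
  have "?G 0 = (\<Sum>i=1..s. - (b i *\<^sub>R Au))"
    by (rule sum.cong) (auto simp: K0)
  also have "\<dots> = - Au"
    using assms(6) by (simp add: sum_negf flip: scaleR_left.sum)
  finally have v'0: "v' 0 = Au" using deriv(1) by simp

  have "AE x in ?M. R (K' i 0) x = - (1 - rk_c s a i) *\<^sub>R DAu_Au x" if i: "i \<in> {1..s}" for i
  proof (rule stage_derivative_at_zero[OF R T assms(4)[OF uD] _ v0 _ K0 _ assms(11) i DAu])
    show "(v has_vector_derivative Au) (at 0 within {0..<\<tau>\<^sub>0})"
      using v zero v'0 unfolding C2_curve_def by metis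
    show "(K j has_vector_derivative K' j 0) (at 0 within {0..<\<tau>\<^sub>0})" if "j \<in> {1..s}" for j
      using K[OF that] zero unfolding C2_curve_def by blast
    show "rk_arg s a t (v t) (\<lambda>j. K j t) i \<in> D" if "t \<in> {0..<\<tau>\<^sub>0}" for t
      using step[OF that] i unfolding rk_step_def by blast
  qed
  then have K'0: "AE x in ?M. \<forall>i\<in>{1..s}. R (K' i 0) x = - (1 - rk_c s a i) *\<^sub>R DAu_Au x"
    by (simp add: AE_finite_all)
  have "v'' 0 = (\<Sum>i=1..s. (- 2 * b i) *\<^sub>R K' i 0)"
    using deriv(2) by (simp add: scaleR_right.sum sum_negf)
  then have "AE x in ?M. R (v'' 0) x = (\<Sum>i=1..s. (- 2 * b i) *\<^sub>R R (K' i 0) x)"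
    using function_space_sum[OF R, of "{1..s}" "\<lambda>i. - 2 * b i" "\<lambda>i. K' i 0"] by simp
  then have v''0: "AE x in ?M. R (v'' 0) x = C_RK s a b *\<^sub>R DAu_Au x"
    using K'0
  proof eventually_elim
    case (elim x)
    have "R (v'' 0) x = (\<Sum>i=1..s. (2 * (b i * (1 - rk_c s a i))) *\<^sub>R DAu_Au x)"
      unfolding elim(1)
    proof (rule sum.cong)
      fix i assume "i \<in> {1..s}"
      then have K': "R (K' i 0) x = - (1 - rk_c s a i) *\<^sub>R DAu_Au x"
        using elim(2) by blast
      have "- 2 * b i * - (1 - rk_c s a i) = 2 * (b i * (1 - rk_c s a i))"
        by (simp add: algebra_simps)
      then show "(- 2 * b i) *\<^sub>R R (K' i 0) x = (2 * (b i * (1 - rk_c s a i))) *\<^sub>R DAu_Au x"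
        by (simp only: K' scaleR_scaleR)
    qed simp
    then show ?case
      by (simp add: C_RK_def sum_distrib_left scaleR_left.sum)
  qed

  let ?r = "\<lambda>x. R Au x \<bullet> (h'' (R u x) *v R Au x)"
  have "continuous_on UNIV h'"
    using assms(3) unfolding C2_fun_def
    by (auto simp: continuous_on_eq_continuous_at intro: has_derivative_continuous)
  moreover have "R w \<in> borel_measurable ?M" for w
    by (rule function_space_measurable[OF R])
  moreover have "DAu_Au \<in> borel_measurable ?M"
    using DAu unfolding represents_def by blast
  moreover have "integrable ?M (\<lambda>x. h' (R u x) \<bullet> R (v'' 0) x + ?r x)"
    using bspec[OF conjunct1[OF ent[unfolded entropy_C2_def]] zero] by (simp add: v0 v'0)
  ultimately have "(LINT x|?M. h' (R u x) \<bullet> R (v'' 0) x + ?r x)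
      = (LINT x|?M. C_RK s a b * (h' (R u x) \<bullet> DAu_Au x) + ?r x)"
    using v''0 by (intro second_variation_cong_AE) auto
  then have "(LINT x|?M. h' (R (v 0) x) \<bullet> R (v'' 0) x + R (v' 0) x \<bullet> (h'' (R (v 0) x) *v R (v' 0) x)) > 0"
    using assms(15) by (simp add: v0 v'0)
  from above_tangent_near_zero[OF T conjunct2[OF ent[unfolded entropy_C2_def]] this]
  show ?thesis by (simp only: v0 v'0 inner_commute)
qed

end
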